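(* Let $a,b>0$ and $n=2m$ with $m$ a positive integer. Let $\hat p_m$ and $\hat q_{m-1}$ be real polynomials of degrees $m$ and $m-1$ respectively satisfying the Pell equation $$\hat p_m^2(s)-\left(s-\frac1a\right)\left(s+\frac1b\right)\hat q_{m-1}^2(s)=1.$$ The polynomials $\hat p_m$ and the parameters $a,b$ have the following properties: - $\hat p_m(s)=T_m\left(\dfrac{2ab}{a+b}s+\dfrac{a-b}{a+b}\right)$, where $T_m$ is the Chebyshev polynomial of degree $m$, defined by $T_m(x)=\cos m\phi$, $x=\cos\phi$; - the condition $\hat q_{m-1}(0)=0$ is equivalent to $$\operatorname{arccot}\sqrt{\frac ab}\in\left\{\frac{k\pi}{n}\ \Big|\ 1\le k<\frac n2,\ \left(k,\frac n2\right)=1\right\}.$$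
   Context: Here $k$ is an integer and $\left(k,\frac n2\right)$ denotes the greatest common divisor of $k$ and $\frac n2=m$. The parameters $a,b$ are those of the ellipse $\frac{x^2}{a}+\frac{y^2}{b}=1$ in the Minkowski plane, i.e. $\mathbb{R}^2$ with the scalar product $\langle X,Y\rangle=X_1Y_1-X_2Y_2$. The Pell equation together with the condition $\hat q_{m-1}(0)=0$ arises as the characterization of periodicity with period $n=2m$ for light-like billiard trajectories within this ellipse, that is, trajectories whose velocity $v$ satisfies $\langle v,v\rangle=0$ at each point.
   Formalization: p is determined only up to sign, so p = ±T_m(...) is proved; q(0)=0 is equivalent to the set without (k,n/2)=1 (a=b, m=4 refutes the coprime version), and the displayed set to q(0)=0 plus non-vanishing at 0 of q' for all Pell pairs (p',q') of degrees j, j-1, 0<j<m. *)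

theory Defs
  imports Complex_Main "HOL-Computational_Algebra.Polynomial"
begin

definition chebyshev_T :: "nat \<Rightarrow> real poly" where
  "chebyshev_T m = (THE T. \<forall>\<phi>. poly T (cos \<phi>) = cos (real m * \<phi>))"

lemma chebyshev_T_exists:
  "\<exists>T :: real poly. \<forall>\<phi>. poly T (cos \<phi>) = cos (real m * \<phi>)"
proof (induction m rule: less_induct)
  case (less m)
  consider "m = 0" | "m = 1" | k where "m = Suc (Suc k)"
    by (metis One_nat_def not0_implies_Suc)
  then show ?case
  proof cases
    case 1
    then show ?thesis by (intro exI[of _ 1]) simp
  next
    case 2
    then show ?thesis by (intro exI[of _ "[:0, 1:]"]) simp
  next
    case (3 k)
    obtain P :: "real poly" where P: "\<And>\<phi>. poly P (cos \<phi>) = cos (real (Suc k) * \<phi>)"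
      using less.IH[of "Suc k"] 3 by auto
    obtain Q :: "real poly" where Q: "\<And>\<phi>. poly Q (cos \<phi>) = cos (real k * \<phi>)"
      using less.IH[of k] 3 by auto
    have "poly ([:0, 2:] * P - Q) (cos \<phi>) = cos (real m * \<phi>)" for \<phi>
    proof -
      have eq: "real m * \<phi> = real (Suc k) * \<phi> + \<phi>" "real k * \<phi> = real (Suc k) * \<phi> - \<phi>"
        by (simp_all add: 3 algebra_simps)
      show ?thesis
        unfolding poly_diff poly_mult P Q eq cos_add cos_diff by simp
    qed
    then show ?thesis by blast
  qed
qed

lemma chebyshev_T_unique:
  fixes S T :: "real poly"
  assumes "\<forall>\<phi>. poly S (cos \<phi>) = cos (real m * \<phi>)"
    and "\<forall>\<phi>. poly T (cos \<phi>) = cos (real m * \<phi>)"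
  shows "S = T"
proof (rule ccontr)
  assume "S \<noteq> T"
  then have "finite {x. poly (S - T) x = 0}"
    by (intro poly_roots_finite) simp
  moreover have "{-1..1} \<subseteq> {x. poly (S - T) x = 0}"
  proof
    fix x :: real
    assume "x \<in> {-1..1}"
    then have "x = cos (arccos x)" by simp
    then show "x \<in> {x. poly (S - T) x = 0}"
      using assms by (metis (mono_tags) diff_self mem_Collect_eq poly_diff)
  qed
  ultimately have "finite {-1..1::real}"
    by (rule rev_finite_subset)
  then show False
    using infinite_Icc[of "-1::real" 1] by simp
qed

lemma poly_chebyshev_T_cos: "poly (chebyshev_T m) (cos \<phi>) = cos (real m * \<phi>)"
proof -
  have "\<exists>!T :: real poly. \<forall>\<phi>. poly T (cos \<phi>) = cos (real m * \<phi>)"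
    using chebyshev_T_exists chebyshev_T_unique by blast
  from theI'[OF this] show ?thesis
    unfolding chebyshev_T_def by blast
qed

definition arccot :: "real \<Rightarrow> real" where
  "arccot x = (THE \<theta>. 0 < \<theta> \<and> \<theta> < pi \<and> cot \<theta> = x)"

lemma arccot_eq: "arccot x = pi / 2 - arctan x"
  unfolding arccot_def
proof (rule the_equality)
  show "0 < pi / 2 - arctan x \<and> pi / 2 - arctan x < pi \<and> cot (pi / 2 - arctan x) = x"
    using arctan_bounded[of x] tan_arctan[of x]
    by (simp add: cot_def cos_diff sin_diff tan_def del: tan_arctan)
next
  fix \<theta> :: real
  assume \<theta>: "0 < \<theta> \<and> \<theta> < pi \<and> cot \<theta> = x"
  then have "tan (pi / 2 - \<theta>) = x"
    by (simp add: tan_def cot_def cos_diff sin_diff)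
  then have "arctan x = pi / 2 - \<theta>"
    using \<theta> by (intro arctan_unique) auto
  then show "\<theta> = pi / 2 - arctan x" by simp
qed

definition pell_solution :: "real \<Rightarrow> real \<Rightarrow> nat \<Rightarrow> real poly \<Rightarrow> real poly \<Rightarrow> bool" where
  "pell_solution a b m p q \<longleftrightarrow>
     degree p = m \<and> degree q = m - 1 \<and>
     (\<forall>s. (poly p s)\<^sup>2 - (s - 1 / a) * (s + 1 / b) * (poly q s)\<^sup>2 = 1)"

text \<open>
  \<open>q(0) = 0\<close> says that the light-like trajectories close after \<open>2 * m\<close> bounces, so \<open>2 * m\<close> may be
  a proper multiple of the least period: for \<open>a = b\<close> the least period is \<open>4\<close>, and \<open>q(0) = 0\<close> for
  every even \<open>m > 0\<close>. The predicate below makes \<open>2 * m\<close> the least period, given \<open>q(0) = 0\<close>: the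
  condition fails for every smaller even number of bounces, and a closed light-like trajectory
  always has an even number of them.
\<close>

definition no_shorter_period :: "real \<Rightarrow> real \<Rightarrow> nat \<Rightarrow> bool" where
  "no_shorter_period a b m \<longleftrightarrow>
     (\<forall>j p q. 0 < j \<and> j < m \<and> pell_solution a b j p q \<longrightarrow> poly q 0 \<noteq> 0)"

end

theory Submission
  imports Defs
begin

text \<open>
  Over the reals, two solutions \<open>(P, Q)\<close> and \<open>(T, U)\<close> of a polynomial Pell equation with
  \<open>degree P = degree T > 0\<close> agree up to signs: in \<open>(P T - D Q U) (P T + D Q U) = P\<^sup>2 + T\<^sup>2 - 1\<close>
  the right-hand side has degree \<open>2 degree P\<close>, and so has one of the factors, because their sum is
  \<open>2 P T\<close>. The other factor is a constant, and the quotient of the two solutions is a constant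
  solution. The affine map \<open>x = 2ab/(a+b) s + (a-b)/(a+b)\<close> sends \<open>1/a\<close> and \<open>-1/b\<close> to \<open>1\<close> and
  \<open>-1\<close>, so it carries the Chebyshev polynomials \<open>T\<^sub>m\<close>, \<open>U\<^sub>m\<^sub>-\<^sub>1\<close> to a solution of the given equation.
  For \<open>\<theta> = arccot \<surd>(a/b)\<close> the point \<open>s = 0\<close> goes to \<open>cos 2\<theta>\<close>, whence \<open>q(0) = 0\<close> exactly if
  \<open>sin 2m\<theta> = 0\<close>.
\<close>

section \<open>Uniqueness for polynomial Pell equations\<close>

text \<open>Dividing \<open>P + Q sqrt D\<close> by \<open>T + U sqrt D\<close> gives
  \<open>R + S sqrt D\<close>, again of norm 1. If \<open>R\<close> is constant, so is
  \<open>D * S^2 = R^2 - 1\<close>; as \<open>D\<close> is not constant, \<open>S = 0\<close> and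
  \<open>R\<close> is 1 or -1.\<close>

lemma poly_pell_constant_quotient:
  fixes P Q T U D :: "real poly"
  assumes P: "P\<^sup>2 - D * Q\<^sup>2 = 1" and T: "T\<^sup>2 - D * U\<^sup>2 = 1"
    and D: "degree D > 0" and R: "degree (P * T - D * Q * U) = 0"
  shows "(P = T \<and> Q = U) \<or> (P = - T \<and> Q = - U)"
proof -
  define R where "R = P * T - D * Q * U"
  define S where "S = Q * T - P * U"
  have "R\<^sup>2 - D * S\<^sup>2 = (P\<^sup>2 - D * Q\<^sup>2) * (T\<^sup>2 - D * U\<^sup>2)"
    unfolding R_def S_def by algebra
  then have norm: "D * S\<^sup>2 = R\<^sup>2 - 1"
    using P T by (simp add: algebra_simps)
  have "degree R = 0"
    using R by (simp add: R_def)
  then have "degree (R\<^sup>2 - 1) = 0"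
    by (metis degree_1 degree_diff_le degree_power_le le_zero_eq mult_zero_left)
  have S: "S = 0"
  proof (rule ccontr)
    assume "S \<noteq> 0"
    then have "degree (D * S\<^sup>2) \<ge> degree D"
      using D by (subst degree_mult_eq) auto
    then show False
      using D norm \<open>degree (R\<^sup>2 - 1) = 0\<close> by simp
  qed
  then have "R\<^sup>2 = 1"
    using norm by simp
  then have "R = 1 \<or> R = - 1"
    by (simp add: power2_eq_1_iff)
  moreover have "P = R * T"
  proof -
    \<comment> \<open>Multiplying the quotient back by \<open>T + U sqrt D\<close> recovers
      \<open>P\<close> and \<open>Q\<close>.\<close>
    have "P = P * (T\<^sup>2 - D * U\<^sup>2)" using T by simp
    also have "\<dots> = R * T + D * U * S" unfolding R_def S_def by algebra
    finally show ?thesis using S by simp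
  qed
  moreover have "Q = R * U"
  proof -
    have "Q = Q * (T\<^sup>2 - D * U\<^sup>2)" using T by simp
    also have "\<dots> = R * U + T * S" unfolding R_def S_def by algebra
    finally show ?thesis using S by simp
  qed
  ultimately show ?thesis by auto
qed

lemma poly_pell_unique_up_to_sign:
  fixes P Q T U D :: "real poly"
  assumes P: "P\<^sup>2 - D * Q\<^sup>2 = 1" and T: "T\<^sup>2 - D * U\<^sup>2 = 1"
    and D: "degree D > 0" and deg: "degree P = degree T" and pos: "degree P > 0"
  shows "(P = T \<or> P = - T) \<and> (Q = U \<or> Q = - U)"
proof -
  define R where "R = P * T - D * Q * U"
  define R' where "R' = P * T + D * Q * U"
  let ?m = "degree P"
  have P0: "P \<noteq> 0" and T0: "T \<noteq> 0"
    using deg pos by auto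
  have "R * R' = P\<^sup>2 * T\<^sup>2 - (D * Q\<^sup>2) * (D * U\<^sup>2)"
    unfolding R_def R'_def by algebra
  also have "\<dots> = P\<^sup>2 * T\<^sup>2 - (P\<^sup>2 - 1) * (T\<^sup>2 - 1)"
    using P T by (simp add: algebra_simps)
  also have "\<dots> = P\<^sup>2 + T\<^sup>2 - 1"
    by (simp add: algebra_simps)
  finally have prod: "R * R' = P\<^sup>2 + T\<^sup>2 - 1" .
  \<comment> \<open>Over the reals the squares of the two leading coefficients cannot cancel, and
    the constant 1 does not reach degree \<open>2 * ?m > 0\<close>. Hence \<open>R * R'\<close> is
    nonzero and the degrees of its factors add up.\<close>
  have "coeff (P\<^sup>2) (2 * ?m) = (lead_coeff P)\<^sup>2" "coeff (T\<^sup>2) (2 * ?m) = (lead_coeff T)\<^sup>2"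
    using lead_coeff_power[of P 2] lead_coeff_power[of T 2] deg P0 T0
    by (simp_all add: degree_power_eq)
  then have "coeff (R * R') (2 * ?m) = (lead_coeff P)\<^sup>2 + (lead_coeff T)\<^sup>2"
    using pos by (simp add: prod)
  also have "\<dots> \<noteq> 0"
    using P0 by (simp add: sum_power2_eq_zero_iff)
  finally have "R * R' \<noteq> 0"
    by auto
  then have "degree R + degree R' = degree (R * R')"
    by (metis degree_mult_eq mult_eq_0_iff)
  also have "\<dots> \<le> 2 * ?m"
    unfolding prod
    by (intro degree_diff_le degree_add_le) (use deg P0 T0 in \<open>simp_all add: degree_power_eq\<close>)
  finally have upper: "degree R + degree R' \<le> 2 * ?m" .
  have "R + R' = P * T + P * T"
    by (simp add: R_def R'_def)
  also have "\<dots> = smult 2 (P * T)"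
    by (metis one_add_one smult_1_left smult_add_left)
  finally have "R + R' = smult 2 (P * T)" .
  then have "degree (R + R') = 2 * ?m"
    using P0 T0 deg by (simp add: degree_mult_eq)
  then have "degree R \<ge> 2 * ?m \<or> degree R' \<ge> 2 * ?m"
    using degree_add_le_max[of R R'] by auto
  then consider "degree R = 0" | "degree R' = 0"
    using upper by linarith
  then show ?thesis
  proof cases
    case 1
    then show ?thesis
      using poly_pell_constant_quotient[OF P T D] by (auto simp: R_def)
  next
    case 2
    \<comment> \<open>Conjugation, replacing \<open>Q\<close> by \<open>- Q\<close>, turns
      \<open>R'\<close> into \<open>R\<close>. This is why the signs of \<open>P\<close> and
      \<open>Q\<close> are independent in the conclusion.\<close>
    have "P\<^sup>2 - D * (- Q)\<^sup>2 = 1"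
      using P by simp
    moreover have "degree (P * T - D * (- Q) * U) = 0"
      using 2 by (simp add: R'_def)
    ultimately show ?thesis
      using poly_pell_constant_quotient[OF _ T D, of P "- Q"] by (auto simp: minus_equation_iff)
  qed
qed

section \<open>The Chebyshev solution\<close>

text \<open>\<open>U\<close> is the Chebyshev polynomial of the second kind of degree
  \<open>m - 1\<close>. With \<open>x = cos \<phi>\<close>, the Pell equation is the identity
  \<open>cos^2 + sin^2 = 1\<close> at the angle \<open>m \<phi>\<close>.\<close>

lemma chebyshev_pell_pair:
  assumes "m > 0"
  obtains U :: "real poly" where
    "(chebyshev_T m)\<^sup>2 - [:-1, 0, 1:] * U\<^sup>2 = 1"
    "degree (chebyshev_T m) = m" "degree U = m - 1"
    "\<And>\<phi>. sin \<phi> * poly U (cos \<phi>) = sin (real m * \<phi>)"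
proof -
  \<comment> \<open>Here \<open>Suc k\<close> stands for \<open>m\<close>. Positive top coefficients
    are carried along so that the leading terms cannot cancel in the recursion; with the degree
    bounds they give the exact degrees.\<close>
  have "\<exists>T U :: real poly. T\<^sup>2 - [:-1, 0, 1:] * U\<^sup>2 = 1 \<and>
      degree T \<le> Suc k \<and> degree U \<le> k \<and> coeff T (Suc k) > 0 \<and> coeff U k > 0 \<and>
      (\<forall>\<phi>. poly T (cos \<phi>) = cos (real (Suc k) * \<phi>)) \<and>
      (\<forall>\<phi>. sin \<phi> * poly U (cos \<phi>) = sin (real (Suc k) * \<phi>))" for k
  proof (induction k)
    case 0
    show ?case
      by (rule exI[of _ "[:0, 1:]"], rule exI[of _ 1]) (simp add: power2_eq_square one_pCons)
  next
    case (Suc k)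
    then obtain T U :: "real poly" where
      pell: "T\<^sup>2 - [:-1, 0, 1:] * U\<^sup>2 = 1" and
      deg: "degree T \<le> Suc k" "degree U \<le> k" and
      lead: "coeff T (Suc k) > 0" "coeff U k > 0" and
      cos: "\<And>\<phi>. poly T (cos \<phi>) = cos (real (Suc k) * \<phi>)" and
      sin: "\<And>\<phi>. sin \<phi> * poly U (cos \<phi>) = sin (real (Suc k) * \<phi>)"
      by blast
    define X :: "real poly" where "X = [:0, 1:]"
    define E :: "real poly" where "E = [:-1, 0, 1:]"
    have E: "E = X\<^sup>2 - 1"
      by (simp add: E_def X_def power2_eq_square one_pCons)
    \<comment> \<open>With \<open>E = x^2 - 1\<close>, this is
      \<open>T' + U' sqrt E = (X + sqrt E) (T + U sqrt E)\<close>. The factor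
      \<open>X + sqrt E\<close> has norm 1, and on cosines the product becomes the addition
      formulas.\<close>
    define T' where "T' = X * T + E * U"
    define U' where "U' = X * U + T"
    have "T'\<^sup>2 - E * U'\<^sup>2 = (X\<^sup>2 - E) * (T\<^sup>2 - E * U\<^sup>2)"
      unfolding T'_def U'_def by algebra
    then have "T'\<^sup>2 - [:-1, 0, 1:] * U'\<^sup>2 = 1"
      using pell unfolding E_def[symmetric] by (simp only: E) simp
    moreover have "degree T' \<le> Suc (Suc k)"
      unfolding T'_def
      by (intro degree_add_le order.trans[OF degree_mult_le]) (use deg in \<open>simp_all add: X_def E_def\<close>)
    moreover have "degree U' \<le> Suc k"
      unfolding U'_def
      by (intro degree_add_le order.trans[OF degree_mult_le]) (use deg in \<open>simp_all add: X_def\<close>)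
    moreover have "coeff T' (Suc (Suc k)) > 0"
    proof -
      \<comment> \<open>The term \<open>-1\<close> of \<open>E\<close> would contribute this
        coefficient; only the \<open>x^2\<close> term of \<open>E\<close> remains.\<close>
      have "coeff U (Suc (Suc k)) = 0"
        using deg by (intro coeff_eq_0) simp
      then show ?thesis
        using lead by (simp add: T'_def X_def E_def)
    qed
    moreover have "coeff U' (Suc k) > 0"
      using lead by (simp add: U'_def X_def)
    moreover have "poly T' (cos \<phi>) = cos (real (Suc (Suc k)) * \<phi>)" for \<phi>
    proof -
      have "real (Suc (Suc k)) * \<phi> = real (Suc k) * \<phi> + \<phi>"
        by (simp add: algebra_simps)
      then have "cos (real (Suc (Suc k)) * \<phi>) =
          poly T (cos \<phi>) * cos \<phi> - (sin \<phi> * poly U (cos \<phi>)) * sin \<phi>"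
        unfolding cos sin by (simp only: cos_add)
      also have "\<dots> = poly T' (cos \<phi>)"
      proof -
        have "(sin \<phi> * poly U (cos \<phi>)) * sin \<phi> = (1 - (cos \<phi>)\<^sup>2) * poly U (cos \<phi>)"
          unfolding sin_squared_eq[symmetric] by (simp add: power2_eq_square)
        then show ?thesis
          by (simp add: T'_def X_def E_def power2_eq_square algebra_simps)
      qed
      finally show ?thesis by simp
    qed
    moreover have "sin \<phi> * poly U' (cos \<phi>) = sin (real (Suc (Suc k)) * \<phi>)" for \<phi>
    proof -
      have "real (Suc (Suc k)) * \<phi> = real (Suc k) * \<phi> + \<phi>"
        by (simp add: algebra_simps)
      then have "sin (real (Suc (Suc k)) * \<phi>) =
          (sin \<phi> * poly U (cos \<phi>)) * cos \<phi> + poly T (cos \<phi>) * sin \<phi>"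
        unfolding cos sin by (simp only: sin_add)
      then show ?thesis
        by (simp add: U'_def X_def algebra_simps)
    qed
    ultimately show ?case by blast
  qed
  from this[of "m - 1"] assms obtain T U :: "real poly" where
    *: "T\<^sup>2 - [:-1, 0, 1:] * U\<^sup>2 = 1" "degree T \<le> m" "degree U \<le> m - 1"
      "coeff T m > 0" "coeff U (m - 1) > 0"
      "\<forall>\<phi>. poly T (cos \<phi>) = cos (real m * \<phi>)"
      "\<And>\<phi>. sin \<phi> * poly U (cos \<phi>) = sin (real m * \<phi>)"
    by auto
  have T: "T = chebyshev_T m"
    using chebyshev_T_unique[OF *(6)] poly_chebyshev_T_cos by blast
  have "degree T = m" "degree U = m - 1"
    using * by (auto intro!: antisym le_degree)
  with * that[of U] show ?thesis
    unfolding T by blast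
qed

text \<open>As \<open>L\<close> takes the values 1 and -1 at \<open>1/a\<close> and
  \<open>-1/b\<close>, \<open>L^2 - 1\<close> is \<open>(s - 1/a) (s + 1/b)\<close> times the square
  of the slope of \<open>L\<close>. The slope is absorbed into the second polynomial.\<close>

lemma pell_solution_chebyshev:
  fixes a b :: real
  assumes a: "a > 0" and b: "b > 0" and m: "m > 0"
  defines "L \<equiv> [:(a - b) / (a + b), 2 * a * b / (a + b):]"
  obtains U where
    "pell_solution a b m (pcompose (chebyshev_T m) L) (smult (2 * a * b / (a + b)) (pcompose U L))"
    "\<And>\<phi>. sin \<phi> * poly U (cos \<phi>) = sin (real m * \<phi>)"
proof -
  obtain U :: "real poly" where
    pell: "(chebyshev_T m)\<^sup>2 - [:-1, 0, 1:] * U\<^sup>2 = 1" and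
    deg: "degree (chebyshev_T m) = m" "degree U = m - 1" and
    sin: "\<And>\<phi>. sin \<phi> * poly U (cos \<phi>) = sin (real m * \<phi>)"
    using chebyshev_pell_pair[OF m] by blast
  define c where "c = 2 * a * b / (a + b)"
  have ab: "a + b \<noteq> 0" and c: "c \<noteq> 0"
    using a b by (auto simp: c_def)
  have degL: "degree L = 1"
    using c by (simp add: L_def c_def)
  have "(poly (chebyshev_T m) x)\<^sup>2 - (x\<^sup>2 - 1) * (poly U x)\<^sup>2 = 1" for x
    using arg_cong[OF pell, of "\<lambda>p. poly p x"] by (simp add: power2_eq_square algebra_simps)
  moreover have "(poly L s)\<^sup>2 - 1 = (s - 1 / a) * (s + 1 / b) * c\<^sup>2" for s
  proof -
    have "poly L s - 1 = c * (s - 1 / a)" "poly L s + 1 = c * (s + 1 / b)"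
      using a b ab by (simp_all add: L_def c_def divide_simps) (simp_all add: algebra_simps)
    then have "(poly L s - 1) * (poly L s + 1) = (s - 1 / a) * (s + 1 / b) * c\<^sup>2"
      by (simp add: power2_eq_square)
    then show ?thesis
      by (simp add: power2_eq_square algebra_simps)
  qed
  ultimately have "(poly (chebyshev_T m) (poly L s))\<^sup>2 -
      (s - 1 / a) * (s + 1 / b) * c\<^sup>2 * (poly U (poly L s))\<^sup>2 = 1" for s
    by metis
  then have "pell_solution a b m (pcompose (chebyshev_T m) L) (smult c (pcompose U L))"
    using deg degL c
    by (simp add: pell_solution_def degree_pcompose poly_pcompose power_mult_distrib mult.assoc)
  then show ?thesis
    using that sin by (simp add: c_def)
qed

lemma pell_solution_poly_eq:
  assumes "pell_solution a b m p q"
  shows "p\<^sup>2 - [:- 1 / a, 1:] * [:1 / b, 1:] * q\<^sup>2 = 1"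
proof (rule poly_ext)
  fix s
  have "poly (p\<^sup>2 - [:- 1 / a, 1:] * [:1 / b, 1:] * q\<^sup>2) s =
      (poly p s)\<^sup>2 - (s - 1 / a) * (s + 1 / b) * (poly q s)\<^sup>2"
    by (simp add: algebra_simps)
  also have "\<dots> = poly 1 s"
    using assms by (simp add: pell_solution_def)
  finally show "poly (p\<^sup>2 - [:- 1 / a, 1:] * [:1 / b, 1:] * q\<^sup>2) s = poly 1 s" .
qed

lemma pell_solution_unique_up_to_sign:
  assumes "pell_solution a b m p q" and "pell_solution a b m p' q'" and "m > 0"
  shows "(p = p' \<or> p = - p') \<and> (q = q' \<or> q = - q')"
proof (rule poly_pell_unique_up_to_sign[OF assms(1,2)[THEN pell_solution_poly_eq]])
  show "degree ([:- 1 / a, 1:] * [:1 / b, 1:]) > 0"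
    by (subst degree_mult_eq) auto
qed (use assms in \<open>auto simp: pell_solution_def\<close>)

section \<open>The angle and the condition \<open>q(0) = 0\<close>\<close>

lemma arccot_sqrt_bounds:
  assumes "a > 0" and "b > 0"
  shows "0 < arccot (sqrt (a / b))" and "arccot (sqrt (a / b)) < pi / 2"
  using assms arctan_ubound[of "sqrt (a / b)"] by (simp_all add: arccot_eq zero_less_arctan_iff)

text \<open>The right-hand side is the image of \<open>s = 0\<close> under the affine map, so the
  value of the second polynomial at 0 becomes a Chebyshev value at twice the angle.\<close>

lemma cos_double_arccot_sqrt:
  assumes "a > 0" and "b > 0"
  shows "cos (2 * arccot (sqrt (a / b))) = (a - b) / (a + b)"
proof -
  have "(sin (arccot (sqrt (a / b))))\<^sup>2 = 1 / (1 + a / b)"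
    using assms by (simp add: arccot_eq sin_diff cos_arctan power_divide)
  then have "cos (2 * arccot (sqrt (a / b))) = 1 - 2 * (1 / (1 + a / b))"
    by (simp add: cos_double_sin)
  also have "\<dots> = (a - b) / (a + b)"
    using assms by (simp add: field_simps)
  finally show ?thesis .
qed

lemma pell_solution_root_iff_sin:
  assumes a: "a > 0" and b: "b > 0" and m: "m > 0" and sol: "pell_solution a b m p q"
  shows "poly q 0 = 0 \<longleftrightarrow> sin (2 * real m * arccot (sqrt (a / b))) = 0"
proof -
  define \<theta> where "\<theta> = arccot (sqrt (a / b))"
  define L where "L = [:(a - b) / (a + b), 2 * a * b / (a + b):]"
  obtain U where U:
    "pell_solution a b m (pcompose (chebyshev_T m) L) (smult (2 * a * b / (a + b)) (pcompose U L))"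
    and sin: "\<And>\<phi>. sin \<phi> * poly U (cos \<phi>) = sin (real m * \<phi>)"
    using pell_solution_chebyshev[OF a b m] unfolding L_def by blast
  have "poly L 0 = cos (2 * \<theta>)"
    by (simp add: L_def \<theta>_def cos_double_arccot_sqrt[OF a b])
  \<comment> \<open>Neither the undetermined sign of \<open>q\<close> nor the nonzero slope factor
    affects vanishing at 0.\<close>
  then have "poly q 0 = 0 \<longleftrightarrow> poly U (cos (2 * \<theta>)) = 0"
    using pell_solution_unique_up_to_sign[OF sol U m] a b by (auto simp: poly_pcompose)
  \<comment> \<open>Since \<open>0 < 2 \<theta> < pi\<close>, this sine can be cancelled from the
    identity for \<open>U\<close>.\<close>
  moreover have "sin (2 * \<theta>) > 0"
    using arccot_sqrt_bounds[OF a b] by (intro sin_gt_zero) (auto simp: \<theta>_def)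
  then have "poly U (cos (2 * \<theta>)) = 0 \<longleftrightarrow> sin (real m * (2 * \<theta>)) = 0"
    using sin[of "2 * \<theta>"] by (metis less_irrefl mult_eq_0_iff)
  ultimately show ?thesis
    by (simp add: \<theta>_def mult_ac)
qed

text \<open>The sine vanishes exactly at the integer multiples of \<open>pi\<close>, and
  \<open>0 < \<theta> < pi / 2\<close> confines the multiplier \<open>k\<close> to
  \<open>0 < k < m\<close>.\<close>

lemma pell_solution_root_iff:
  assumes a: "a > 0" and b: "b > 0" and m: "m > 0" and sol: "pell_solution a b m p q"
  shows "poly q 0 = 0 \<longleftrightarrow> (\<exists>k :: int. 1 \<le> k \<and> k < int m \<and>
    arccot (sqrt (a / b)) = real_of_int k * pi / real (2 * m))"
proof -
  define \<theta> where "\<theta> = arccot (sqrt (a / b))"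
  have \<theta>: "0 < \<theta>" "\<theta> < pi / 2"
    using arccot_sqrt_bounds[OF a b] by (auto simp: \<theta>_def)
  have "poly q 0 = 0 \<longleftrightarrow> (\<exists>k :: int. 2 * real m * \<theta> = real_of_int k * pi)"
    using pell_solution_root_iff_sin[OF assms] by (simp add: \<theta>_def sin_zero_iff_int2)
  also have "\<dots> \<longleftrightarrow> (\<exists>k :: int. 1 \<le> k \<and> k < int m \<and> 2 * real m * \<theta> = real_of_int k * pi)"
  proof safe
    fix k :: int
    assume k: "2 * real m * \<theta> = real_of_int k * pi"
    have "0 < real_of_int k * pi" "real_of_int k * pi < real m * pi"
      using \<theta> m by (simp_all flip: k)
    then have "1 \<le> k \<and> k < int m"
      by (auto simp: zero_less_mult_iff)
    with k show "\<exists>k :: int. 1 \<le> k \<and> k < int m \<and> 2 * real m * \<theta> = real_of_int k * pi"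
      by blast
  qed blast
  also have "\<dots> \<longleftrightarrow> (\<exists>k :: int. 1 \<le> k \<and> k < int m \<and> \<theta> = real_of_int k * pi / real (2 * m))"
    using m by (simp add: field_simps)
  finally show ?thesis
    by (simp add: \<theta>_def)
qed

section \<open>Least period and coprimality\<close>

text \<open>A root at 0 for index \<open>j\<close> means that \<open>2 \<theta> / pi\<close> is a
  fraction with denominator \<open>j\<close>. Hence \<open>m\<close> is the least such index exactly
  if \<open>k / m\<close> is in lowest terms.\<close>

lemma no_shorter_period_iff_coprime:
  assumes a: "a > 0" and b: "b > 0" and k: "1 \<le> k" "k < int m"
    and angle: "arccot (sqrt (a / b)) = real_of_int k * pi / real (2 * m)"
  shows "no_shorter_period a b m \<longleftrightarrow> gcd k (int m) = 1"
proof
  have m: "m > 0"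
    using k by auto
  show "gcd k (int m) = 1" if "no_shorter_period a b m"
  proof (rule ccontr)
    assume "gcd k (int m) \<noteq> 1"
    define g where "g = gcd k (int m)"
    have g: "g > 1"
      using \<open>gcd k (int m) \<noteq> 1\<close> m gcd_pos_int[of k "int m"] unfolding g_def by linarith
    obtain k' where k': "k = g * k'"
      unfolding g_def by (meson dvdE gcd_dvd1)
    obtain j' where j': "int m = g * j'"
      unfolding g_def by (meson dvdE gcd_dvd2)
    have "0 < g * j'" "0 < g * k'"
      using m k by (simp_all flip: j' k')
    then have "j' > 0" "k' > 0"
      using g by (simp_all add: zero_less_mult_iff)
    define j where "j = nat j'"
    have j: "int m = g * int j" "j > 0"
      using j' \<open>j' > 0\<close> by (simp_all add: j_def)
    have "int j < g * int j"
      using j g by simp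
    then have "j < m"
      using j(1) by linarith
    \<comment> \<open>\<open>no_shorter_period\<close> speaks of solutions of index
      \<open>j\<close>, so refuting it takes an actual one; the Chebyshev solution serves.\<close>
    obtain p q where sol: "pell_solution a b j p q"
      using pell_solution_chebyshev[OF a b j(2)] by blast
    have "real m = real_of_int g * real j"
      using arg_cong[OF j(1), of real_of_int] by simp
    then have "arccot (sqrt (a / b)) = real_of_int k' * pi / real (2 * j)"
      using angle g k' by simp
    moreover have "1 \<le> k'" "k' < int j"
      using k(2) g \<open>k' > 0\<close> unfolding k' j by simp_all
    ultimately have "poly q 0 = 0"
      using pell_solution_root_iff[OF a b j(2) sol] by blast
    then show False
      using that \<open>j < m\<close> j sol by (auto simp: no_shorter_period_def)
  qed
  show "no_shorter_period a b m" if coprime: "gcd k (int m) = 1"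
    unfolding no_shorter_period_def
  proof safe
    fix j p q
    assume j: "0 < j" "j < m" and sol: "pell_solution a b j p q" and "poly q 0 = 0"
    then obtain l :: int where "arccot (sqrt (a / b)) = real_of_int l * pi / real (2 * j)"
      using pell_solution_root_iff[OF a b j(1) sol] by blast
    \<comment> \<open>Both fractions \<open>k / m\<close> and \<open>l / j\<close> equal
      \<open>2 \<theta> / pi\<close>; coprimality makes \<open>m\<close> divide the smaller positive
      number \<open>j\<close>.\<close>
    with angle have "real_of_int k * real j = real_of_int l * real m"
      using j m by (simp add: field_simps)
    then have "k * int j = l * int m"
      by (metis of_int_eq_iff of_int_mult of_int_of_nat_eq)
    then have "int m dvd k * int j"
      by simp
    then have "int m dvd int j"
      using coprime by (simp add: coprime_dvd_mult_right_iff coprime_iff_gcd_eq_1 gcd.commute)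
    then show False
      using j by (simp add: nat_dvd_not_less)
  qed
qed

text \<open>Both signs occur in the first part, since \<open>- p\<close> solves the equation along
  with \<open>p\<close>. The root condition alone does not force coprimality: for
  \<open>a = b\<close> the angle is \<open>pi / 4\<close>, and \<open>m = 4\<close> gives
  \<open>k = 2\<close>. Coprimality enters only with the least period.\<close>

theorem proposition9p2:
  fixes a b :: real and m n :: nat and p q :: "real poly"
  assumes "a > 0" and "b > 0"
    and "m > 0" and "n = 2 * m"
    and "pell_solution a b m p q"
  shows
    "((\<forall>s. poly p s = poly (chebyshev_T m) (2 * a * b / (a + b) * s + (a - b) / (a + b))) \<or>
      (\<forall>s. poly p s = - poly (chebyshev_T m) (2 * a * b / (a + b) * s + (a - b) / (a + b)))) \<and>
     (poly q 0 = 0 \<longleftrightarrow>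
      arccot (sqrt (a / b)) \<in>
        {real_of_int k * pi / real n | k :: int. 1 \<le> k \<and> real_of_int k < real n / 2}) \<and>
     (poly q 0 = 0 \<and> no_shorter_period a b m \<longleftrightarrow>
      arccot (sqrt (a / b)) \<in>
        {real_of_int k * pi / real n | k :: int.
           1 \<le> k \<and> real_of_int k < real n / 2 \<and> gcd k (int m) = 1})"
proof -
  define L where "L = [:(a - b) / (a + b), 2 * a * b / (a + b):]"
  obtain q' where "pell_solution a b m (pcompose (chebyshev_T m) L) q'"
    using pell_solution_chebyshev[OF assms(1-3)] unfolding L_def by blast
  then have "p = pcompose (chebyshev_T m) L \<or> p = - pcompose (chebyshev_T m) L"
    using pell_solution_unique_up_to_sign[OF assms(5) _ assms(3)] by blast
  then have "(\<forall>s. poly p s = poly (chebyshev_T m) (2 * a * b / (a + b) * s + (a - b) / (a + b))) \<or>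
      (\<forall>s. poly p s = - poly (chebyshev_T m) (2 * a * b / (a + b) * s + (a - b) / (a + b)))"
    by (auto simp: poly_pcompose L_def add.commute mult.commute)
  moreover have "real n / 2 = real_of_int (int m)"
    using assms(4) by simp
  moreover have root: "poly q 0 = 0 \<longleftrightarrow> (\<exists>k :: int. arccot (sqrt (a / b)) = real_of_int k * pi / real n \<and>
      1 \<le> k \<and> k < int m)"
    using pell_solution_root_iff[OF assms(1-3,5)] assms(4) by blast
  moreover have "poly q 0 = 0 \<and> no_shorter_period a b m \<longleftrightarrow>
      (\<exists>k :: int. arccot (sqrt (a / b)) = real_of_int k * pi / real n \<and>
        1 \<le> k \<and> k < int m \<and> gcd k (int m) = 1)"
  proof -
    \<comment> \<open>The equivalence holds for every \<open>k\<close> representing the angle, so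
      coprimality can be moved under the existential quantifier.\<close>
    have "no_shorter_period a b m \<longleftrightarrow> gcd k (int m) = 1"
      if "arccot (sqrt (a / b)) = real_of_int k * pi / real n \<and> 1 \<le> k \<and> k < int m" for k
      using no_shorter_period_iff_coprime[OF assms(1,2)] that assms(4) by simp
    then show ?thesis
      unfolding root by metis
  qed
  ultimately show ?thesis
    by (simp only: mem_Collect_eq of_int_less_iff)
qed

end
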